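(* Let $G = C \wr \mathbb{Z}$ be the restricted wreath product, where $C$ is a non-trivial (finite or infinite) cyclic group. Let $S := \{a, t\}$ be a generating set for $G$ with $a \in C_i$ for some $i \in \mathbb{Z}$ and with $t$ in the head $\mathbb{Z}$ of $G$. Then $\mathrm{dc}_S(G) = 0$.
   Context: Restricted wreath product: for groups $K$ and $H$, $K \wr H$ is the semidirect product $B \rtimes H$, where the base $B$ is the group (under pointwise multiplication) of all functions $f : H \to K$ with $f(h) \neq 1$ for only finitely many $h \in H$, and the head $H$ acts on $B$ by $(k^{-1} f k)(h) := f(hk^{-1})$ for $h,k \in H$, $f\in B$. For $h \in H$, $K_h$ denotes the copy of $K$ in the base corresponding to $h$, i.e. the functions that are trivial outside $\{h\}$; thus $C_i$ is the $i$-th copy of $C$ in the base of $C \wr \mathbb{Z}$. Word length and balls: if $G$ is a group with finite generating set $S$, then $|g|_S$ is the least length of a word in $S \cup S^{-1}$ representing $g \in G$, and $\mathbb{B}_S(n) = \{g \in G : |g|_S \leqslant n\}$ for $n \in \mathbb{N}$ (the ball of radius $n$ in the Cayley graph). Degree of commutativity: for a group $G$ with finite generating set $S$, $$\mathrm{dc}_S(G) := \limsup_{n \to \infty} \frac{|\{(a,b) \in \mathbb{B}_S(n)^2 : ab = ba\}|}{|\mathbb{B}_S(n)|^2}.$$ *)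

theory Defs
  imports "HOL-Algebra.Product_Groups" "HOL-Library.Extended_Real"
begin

section \<open>Restricted wreath products\<close>

definition wreath_base ::
    "('k, 'c) monoid_scheme \<Rightarrow> ('h, 'd) monoid_scheme \<Rightarrow> ('h \<Rightarrow> 'k) monoid"
  where "wreath_base K H = sum_group (carrier H) (\<lambda>_. K)"

text \<open>The function \<open>h \<mapsto> f (h k\<^sup>-\<^sup>1)\<close>, i.e. the conjugate \<open>k\<^sup>-\<^sup>1 f k\<close>; this is a right action of
  \<open>H\<close> on the base.\<close>

definition wreath_shift ::
    "('h, 'd) monoid_scheme \<Rightarrow> ('h \<Rightarrow> 'k) \<Rightarrow> 'h \<Rightarrow> ('h \<Rightarrow> 'k)"
  where "wreath_shift H f k = (\<lambda>h\<in>carrier H. f (h \<otimes>\<^bsub>H\<^esub> inv\<^bsub>H\<^esub> k))"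

text \<open>The pair \<open>(f, h)\<close> stands for the product \<open>f h\<close> of the base element \<open>f\<close> and the head element
  \<open>h\<close>. Hence \<open>(f, h) (f', h') = f (h f' h\<^sup>-\<^sup>1) (h h')\<close>, where \<open>h f' h\<^sup>-\<^sup>1\<close> is the shift of \<open>f'\<close>
  by \<open>h\<^sup>-\<^sup>1\<close>.\<close>

definition wreath_product ::
    "('k, 'c) monoid_scheme \<Rightarrow> ('h, 'd) monoid_scheme \<Rightarrow> (('h \<Rightarrow> 'k) \<times> 'h) monoid"
  where "wreath_product K H =
    \<lparr>carrier = carrier (wreath_base K H) \<times> carrier H,
     monoid.mult = (\<lambda>(f, h) (f', h').
       (f \<otimes>\<^bsub>wreath_base K H\<^esub> wreath_shift H f' (inv\<^bsub>H\<^esub> h), h \<otimes>\<^bsub>H\<^esub> h')),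
     one = (\<one>\<^bsub>wreath_base K H\<^esub>, \<one>\<^bsub>H\<^esub>)\<rparr>"

text \<open>The head and the copies of \<open>K\<close> in the base, as subsets of the wreath product.\<close>

definition wreath_head ::
    "('k, 'c) monoid_scheme \<Rightarrow> ('h, 'd) monoid_scheme \<Rightarrow> (('h \<Rightarrow> 'k) \<times> 'h) set"
  where "wreath_head K H = {(\<one>\<^bsub>wreath_base K H\<^esub>, h) | h. h \<in> carrier H}"

definition wreath_copy ::
    "('k, 'c) monoid_scheme \<Rightarrow> ('h, 'd) monoid_scheme \<Rightarrow> 'h \<Rightarrow> (('h \<Rightarrow> 'k) \<times> 'h) set"
  where "wreath_copy K H i =
    {(f, \<one>\<^bsub>H\<^esub>) | f. f \<in> carrier (wreath_base K H) \<and> (\<forall>h\<in>carrier H - {i}. f h = \<one>\<^bsub>K\<^esub>)}"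

lemma carrier_wreath_base:
  assumes "group K"
  shows "carrier (wreath_base K H) =
    {f \<in> carrier H \<rightarrow>\<^sub>E carrier K. finite {h \<in> carrier H. f h \<noteq> \<one>\<^bsub>K\<^esub>}}"
  using assms by (simp add: wreath_base_def carrier_sum_group)

lemma mult_wreath_base:
  "f \<otimes>\<^bsub>wreath_base K H\<^esub> g = (\<lambda>h\<in>carrier H. f h \<otimes>\<^bsub>K\<^esub> g h)"
  by (simp add: wreath_base_def)

lemma one_wreath_base: "\<one>\<^bsub>wreath_base K H\<^esub> = (\<lambda>h\<in>carrier H. \<one>\<^bsub>K\<^esub>)"
  by (simp add: wreath_base_def)

lemma group_wreath_base: "group K \<Longrightarrow> group (wreath_base K H)"
  by (simp add: wreath_base_def)

lemma wreath_shift_closed: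
  assumes "group K" "group H" "f \<in> carrier (wreath_base K H)" "k \<in> carrier H"
  shows "wreath_shift H f k \<in> carrier (wreath_base K H)"
proof -
  interpret H: group H by fact
  let ?A = "{h \<in> carrier H. f h \<noteq> \<one>\<^bsub>K\<^esub>}"
  have "{h \<in> carrier H. wreath_shift H f k h \<noteq> \<one>\<^bsub>K\<^esub>} \<subseteq> (\<lambda>h. h \<otimes>\<^bsub>H\<^esub> k) ` ?A"
  proof
    fix h assume "h \<in> {h \<in> carrier H. wreath_shift H f k h \<noteq> \<one>\<^bsub>K\<^esub>}"
    then have "h \<in> carrier H" "h \<otimes>\<^bsub>H\<^esub> inv\<^bsub>H\<^esub> k \<in> ?A"
      using assms by (auto simp: wreath_shift_def)
    moreover have "h = (h \<otimes>\<^bsub>H\<^esub> inv\<^bsub>H\<^esub> k) \<otimes>\<^bsub>H\<^esub> k"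
      using \<open>h \<in> carrier H\<close> assms by (simp add: H.m_assoc)
    ultimately show "h \<in> (\<lambda>h. h \<otimes>\<^bsub>H\<^esub> k) ` ?A" by blast
  qed
  moreover have "finite ?A"
    using assms by (simp add: carrier_wreath_base)
  ultimately have "finite {h \<in> carrier H. wreath_shift H f k h \<noteq> \<one>\<^bsub>K\<^esub>}"
    using finite_surj by blast
  then show ?thesis
    using assms by (auto simp: carrier_wreath_base wreath_shift_def)
qed

lemma group_wreath_product:
  assumes "group K" "group H"
  shows "group (wreath_product K H)"
proof -
  interpret K: group K by fact
  interpret H: group H by fact
  interpret B: group "wreath_base K H" using assms(1) by (rule group_wreath_base)
  note defs = wreath_product_def mult_wreath_base one_wreath_base wreath_shift_def
  have car: "f h \<in> carrier K" if "f \<in> carrier (wreath_base K H)" "h \<in> carrier H" for f h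
    using that assms by (auto simp: carrier_wreath_base)
  have ext: "f \<in> extensional (carrier H)" if "f \<in> carrier (wreath_base K H)" for f
    using that assms by (auto simp: carrier_wreath_base PiE_def)
  show ?thesis
  proof (rule groupI)
    fix x y assume "x \<in> carrier (wreath_product K H)" "y \<in> carrier (wreath_product K H)"
    then show "x \<otimes>\<^bsub>wreath_product K H\<^esub> y \<in> carrier (wreath_product K H)"
      using assms by (auto simp: wreath_product_def wreath_shift_closed)
  next
    show "\<one>\<^bsub>wreath_product K H\<^esub> \<in> carrier (wreath_product K H)"
      by (simp add: wreath_product_def)
  next
    fix x y z
    assume "x \<in> carrier (wreath_product K H)" "y \<in> carrier (wreath_product K H)"
      "z \<in> carrier (wreath_product K H)"
    then show "x \<otimes>\<^bsub>wreath_product K H\<^esub> y \<otimes>\<^bsub>wreath_product K H\<^esub> z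
        = x \<otimes>\<^bsub>wreath_product K H\<^esub> (y \<otimes>\<^bsub>wreath_product K H\<^esub> z)"
      by (auto simp: defs car K.m_assoc H.m_assoc H.inv_mult_group intro!: restrict_ext)
  next
    fix x assume "x \<in> carrier (wreath_product K H)"
    then show "\<one>\<^bsub>wreath_product K H\<^esub> \<otimes>\<^bsub>wreath_product K H\<^esub> x = x"
      by (auto simp: defs car intro!: extensionalityI[OF restrict_extensional ext])
  next
    fix x assume "x \<in> carrier (wreath_product K H)"
    then obtain f h where x: "x = (f, h)"
      and f: "f \<in> carrier (wreath_base K H)" and h: "h \<in> carrier H"
      by (auto simp: wreath_product_def)
    let ?f' = "inv\<^bsub>wreath_base K H\<^esub> (wreath_shift H f h)"
    have sh: "wreath_shift H f h \<in> carrier (wreath_base K H)"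
      using assms f h by (rule wreath_shift_closed)
    then have "?f' \<otimes>\<^bsub>wreath_base K H\<^esub> wreath_shift H f (inv\<^bsub>H\<^esub> (inv\<^bsub>H\<^esub> h)) = \<one>\<^bsub>wreath_base K H\<^esub>"
      using h by simp
    then have "(?f', inv\<^bsub>H\<^esub> h) \<otimes>\<^bsub>wreath_product K H\<^esub> x = \<one>\<^bsub>wreath_product K H\<^esub>"
      using h by (simp add: x wreath_product_def)
    moreover have "(?f', inv\<^bsub>H\<^esub> h) \<in> carrier (wreath_product K H)"
      using h sh by (simp add: wreath_product_def)
    ultimately show "\<exists>y\<in>carrier (wreath_product K H).
        y \<otimes>\<^bsub>wreath_product K H\<^esub> x = \<one>\<^bsub>wreath_product K H\<^esub>"
      by blast
  qed
qed

lemma wreath_conj: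
  assumes "group K" "group H" "f \<in> carrier (wreath_base K H)" "k \<in> carrier H"
  defines "W \<equiv> wreath_product K H" and "e \<equiv> \<one>\<^bsub>wreath_base K H\<^esub>"
  shows "inv\<^bsub>W\<^esub> (e, k) \<otimes>\<^bsub>W\<^esub> (f, \<one>\<^bsub>H\<^esub>) \<otimes>\<^bsub>W\<^esub> (e, k) = (wreath_shift H f k, \<one>\<^bsub>H\<^esub>)"
proof -
  interpret H: group H by fact
  interpret B: group "wreath_base K H" using assms(1) by (rule group_wreath_base)
  interpret W: group W unfolding W_def using assms(1,2) by (rule group_wreath_product)
  have e: "wreath_shift H e h = e" if "h \<in> carrier H" for h
    using that by (auto simp: e_def one_wreath_base wreath_shift_def intro!: restrict_ext)
  have "inv\<^bsub>W\<^esub> (e, k) = (e, inv\<^bsub>H\<^esub> k)"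
    by (rule W.inv_equality) (use assms e in \<open>auto simp: W_def wreath_product_def e_def\<close>)
  then show ?thesis
    using assms e wreath_shift_closed[OF assms(1-4)]
    by (simp add: W_def wreath_product_def e_def)
qed

section \<open>Word length and degree of commutativity\<close>

text \<open>\<open>word_length G S g\<close> is unspecified when \<open>g\<close> is not generated by \<open>S\<close>, and \<open>deg_comm G S\<close> is
  meaningful only for finite \<open>S\<close> generating \<open>G\<close>.\<close>

definition word_length :: "('a, 'b) monoid_scheme \<Rightarrow> 'a set \<Rightarrow> 'a \<Rightarrow> nat"
  where "word_length G S g =
    (LEAST n. \<exists>w. length w = n \<and> set w \<subseteq> S \<union> m_inv G ` S \<and> foldr (\<otimes>\<^bsub>G\<^esub>) w \<one>\<^bsub>G\<^esub> = g)"

definition word_ball :: "('a, 'b) monoid_scheme \<Rightarrow> 'a set \<Rightarrow> nat \<Rightarrow> 'a set"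
  where "word_ball G S n = {g \<in> carrier G. word_length G S g \<le> n}"

definition deg_comm :: "('a, 'b) monoid_scheme \<Rightarrow> 'a set \<Rightarrow> ereal"
  where "deg_comm G S = limsup (\<lambda>n. ereal (
    real (card {(x, y). x \<in> word_ball G S n \<and> y \<in> word_ball G S n \<and> x \<otimes>\<^bsub>G\<^esub> y = y \<otimes>\<^bsub>G\<^esub> x})
      / (real (card (word_ball G S n)))\<^sup>2))"

end

(*
  Project G onto Z. An element outside the base has a centralizer that injects into Z, so the pairs
  with an entry outside the base contribute at most 2 (2n + 1) |B(n)|, which is negligible because
  balls grow exponentially. It remains to see that the base has density 0 in B(n). If f lies in the
  base and in B(n), and its support contains a point at distance at least m from the site of the
  generator a, then a closed walk realising f reaches that far, and it can be cut open to end at any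
  of the m + 1 intermediate sites while still realising f; so there are at most |B(n)| / (m + 1)
  such f. The other f live on 2m + 1 sites and take at most 2n + 1 values on each, hence are only
  polynomially many.
*)

theory Submission
  imports Defs "HOL-Real_Asymp.Real_Asymp"
begin

section \<open>Integer walks and translation of finite sets of integers\<close>

text \<open>A discrete intermediate value theorem: increments are at most 1, so partial sums cannot
  jump over \<open>k\<close>. Letters are dropped from the right until the sum falls below
  \<open>k\<close>; the last one dropped is \<open>x\<close>.\<close>

lemma prefix_sum_eq:
  fixes g :: "'x \<Rightarrow> int"
  assumes "\<And>x. x \<in> set w \<Longrightarrow> g x \<le> 1" "1 \<le> k" "k \<le> sum_list (map g w)"
  shows "\<exists>u x v. w = u @ x # v \<and> g x = 1 \<and> sum_list (map g u) = k - 1"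
  using assms
proof (induction w rule: rev_induct)
  case Nil
  then show ?case by simp
next
  case (snoc x w)
  show ?case
  proof (cases "k \<le> sum_list (map g w)")
    case True
    then obtain u y v where "w = u @ y # v" "g y = 1" "sum_list (map g u) = k - 1"
      using snoc by auto
    then show ?thesis by (intro exI[of _ u] exI[of _ y] exI[of _ "v @ [x]"]) simp
  next
    case False
    then have "g x = 1" "sum_list (map g w) = k - 1"
      using snoc.prems(1)[of x] snoc.prems(3) by auto
    then show ?thesis by (intro exI[of _ w] exI[of _ x] exI[of _ "[]"]) simp
  qed
qed

text \<open>The translates of a single element by the multiples of \<open>k\<close> would already be
  infinitely many.\<close>

lemma finite_shift_closed_int_empty:
  fixes A :: "int set"
  assumes "finite A" "k \<noteq> 0" "\<And>p. p \<in> A \<Longrightarrow> p + k \<in> A"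
  shows "A = {}"
proof (rule ccontr)
  assume "A \<noteq> {}"
  then obtain p where p: "p \<in> A" by blast
  have "p + int j * k \<in> A" for j
  proof (induction j)
    case (Suc j)
    from assms(3)[OF this] show ?case by (simp add: algebra_simps)
  qed (simp add: p)
  then have "range (\<lambda>j. p + int j * k) \<subseteq> A" by blast
  moreover have "inj (\<lambda>j. p + int j * k)"
    using assms(2) by (auto simp: inj_on_def)
  ultimately show False
    using assms(1) by (metis finite_subset range_inj_infinite)
qed

section \<open>Elements, words and balls in coordinates\<close>

text \<open>The parameter \<open>c\<close> is the value of the base generator at its site
  \<open>i\<close>. Generation of the whole group is kept out of the locale and enters only when
  \<open>ball\<close> is compared with \<open>word_ball\<close>.\<close>

locale wreath_int = comm_group C for C :: "('a, 'b) monoid_scheme" (structure) +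
  fixes i :: int and c :: 'a
  assumes c_closed [simp]: "c \<in> carrier C" and c_nontrivial: "c \<noteq> \<one>"
begin

definition W :: "((int \<Rightarrow> 'a) \<times> int) monoid"
  where "W = wreath_product C integer_group"

definition spot :: "'a \<Rightarrow> (int \<Rightarrow> 'a) \<times> int"
  where "spot x = ((\<lambda>p. if p = i then x else \<one>), 0)"

definition step :: "int \<Rightarrow> (int \<Rightarrow> 'a) \<times> int"
  where "step s = ((\<lambda>_. \<one>), s)"

text \<open>The two generators with their inverses; by symmetry this covers both
  \<open>t = step 1\<close> and \<open>t = step (-1)\<close>.\<close>

definition letters :: "((int \<Rightarrow> 'a) \<times> int) set"
  where "letters = {spot c, spot (inv c), step 1, step (-1)}"

definition ev :: "((int \<Rightarrow> 'a) \<times> int) list \<Rightarrow> (int \<Rightarrow> 'a) \<times> int"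
  where "ev w = foldr (\<otimes>\<^bsub>W\<^esub>) w \<one>\<^bsub>W\<^esub>"

definition ball :: "nat \<Rightarrow> ((int \<Rightarrow> 'a) \<times> int) set"
  where "ball n = {ev w | w. w \<in> lists letters \<and> length w \<le> n}"

definition base :: "((int \<Rightarrow> 'a) \<times> int) set"
  where "base = {x. snd x = 0}"

text \<open>Fixes the sign convention: a letter \<open>spot x\<close> read after a prefix with head
  component \<open>s\<close> acts on the site \<open>i - s\<close>.\<close>

lemma mult_W: "x \<otimes>\<^bsub>W\<^esub> y = ((\<lambda>p. fst x p \<otimes> fst y (p + snd x)), snd x + snd y)"
  by (cases x; cases y)
    (simp add: W_def wreath_product_def mult_wreath_base wreath_shift_def restrict_def)

lemma one_W: "\<one>\<^bsub>W\<^esub> = ((\<lambda>_. \<one>), 0)"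
  by (simp add: W_def wreath_product_def one_wreath_base restrict_def)

lemma carrier_W: "x \<in> carrier W \<longleftrightarrow> range (fst x) \<subseteq> carrier C \<and> finite {p. fst x p \<noteq> \<one>}"
  by (cases x) (auto simp: W_def wreath_product_def carrier_wreath_base)

sublocale W: group W
  unfolding W_def by (rule group_wreath_product) (simp_all add: is_group)

lemma fst_closed [simp]: "x \<in> carrier W \<Longrightarrow> fst x p \<in> carrier C"
  by (auto simp: carrier_W)

lemma spot_carrier: "x \<in> carrier C \<Longrightarrow> spot x \<in> carrier W"
  by (auto simp: carrier_W spot_def intro: finite_subset[of _ "{i}"])

lemma step_carrier: "step s \<in> carrier W"
  by (auto simp: carrier_W step_def)

lemma letters_carrier: "letters \<subseteq> carrier W"
  by (auto simp: letters_def spot_carrier step_carrier)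

lemma finite_letters: "finite letters"
  by (simp add: letters_def)

lemma inv_spot: "x \<in> carrier C \<Longrightarrow> inv\<^bsub>W\<^esub> (spot x) = spot (inv x)"
  by (rule W.inv_equality) (auto simp: spot_carrier, auto simp: spot_def mult_W one_W)

lemma inv_step: "inv\<^bsub>W\<^esub> (step s) = step (- s)"
  by (rule W.inv_equality) (auto simp: step_carrier, auto simp: step_def mult_W one_W)

lemma ev_Nil [simp]: "ev [] = \<one>\<^bsub>W\<^esub>"
  and ev_Cons [simp]: "ev (x # w) = x \<otimes>\<^bsub>W\<^esub> ev w"
  by (simp_all add: ev_def)

lemma ev_carrier: "w \<in> lists letters \<Longrightarrow> ev w \<in> carrier W"
  by (induction w) (use letters_carrier in auto)

lemma ev_append:
  "u \<in> lists letters \<Longrightarrow> v \<in> lists letters \<Longrightarrow> ev (u @ v) = ev u \<otimes>\<^bsub>W\<^esub> ev v"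
proof (induction u)
  case (Cons x u)
  then have "x \<in> carrier W" "ev u \<in> carrier W" "ev v \<in> carrier W"
    using letters_carrier by (auto intro: ev_carrier)
  with Cons show ?case by (simp add: W.m_assoc)
qed (simp add: ev_carrier)

lemma snd_ev: "snd (ev w) = sum_list (map snd w)"
  by (induction w) (simp_all add: mult_W one_W)

section \<open>Cutting closed walks open\<close>

lemma letter_cases:
  assumes "x \<in> letters" "s = 1 \<or> s = -1"
  obtains "snd x = 0" | "x = step s" | "x = step (- s)"
  using assms by (auto simp: letters_def spot_def step_def)

text \<open>Cutting one descent out of a closed walk: everything done on the way back from the site
  \<open>s j\<close> can be done earlier, at the first passage through the respective site, because the base is
  abelian.\<close>

lemma walk_surgery:
  assumes "s = 1 \<or> s = -1" "u \<in> lists letters" "v \<in> lists letters"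
    and "snd (ev u) = s * k" "snd (ev (u @ v)) = 0" "0 \<le> j" "j \<le> k"
  shows "\<exists>w \<in> lists letters. ev w = (fst (ev (u @ v)), s * j) \<and> length w \<le> length u + length v"
  using assms(2-)
proof (induction v arbitrary: u j k)
  case Nil
  then have "j = 0" using assms(1) by auto
  with Nil show ?case by (intro bexI[of _ u]) (auto simp: prod_eq_iff)
next
  case (Cons x v)
  have x: "x \<in> letters" and v: "v \<in> lists letters" and u: "u \<in> lists letters"
    using Cons.prems by auto
  \<comment> \<open>Here \<open>d\<close> is the displacement of \<open>x\<close> in the direction
    \<open>s\<close>. If the walk is not below \<open>j\<close> after \<open>x\<close>, then
    \<open>x\<close> can be moved from the second part to the end of \<open>u\<close>.\<close>
  have IH: ?case if "snd x = s * d" "j \<le> k + d" for d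
  proof -
    have "snd (ev (u @ [x])) = s * (k + d)"
      using that Cons.prems(3) by (simp add: snd_ev algebra_simps)
    then have "\<exists>w \<in> lists letters. ev w = (fst (ev ((u @ [x]) @ v)), s * j)
        \<and> length w \<le> length (u @ [x]) + length v"
      using that Cons.prems by (intro Cons.IH) auto
    then show ?thesis by simp
  qed
  from x assms(1) show ?case
  proof (cases rule: letter_cases)
    case 1
    then show ?thesis using IH[of 0] Cons.prems by simp
  next
    case 2
    then show ?thesis using IH[of 1] Cons.prems by (simp add: step_def)
  next
    case x_back: 3
    show ?thesis
    proof (cases "j \<le> k - 1")
      case True
      then show ?thesis using IH[of "-1"] x_back by (simp add: step_def)
    next
      case False
      then have jk: "j = k" using Cons.prems by simp
      show ?thesis
      proof (cases "k = 0")
        case True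
        with jk Cons.prems show ?thesis
          by (intro bexI[of _ "u @ x # v"]) (auto simp: prod_eq_iff)
      next
        case False
        have ss: "s * s = 1" using assms(1) by auto
        \<comment> \<open>The walk leaves the target \<open>s * k\<close> by \<open>x\<close>. To
          cut this descent out, a matching ascent \<open>y\<close> from \<open>s * (k - 1)\<close>
          to \<open>s * k\<close> is sought in \<open>u\<close>.\<close>
        have "sum_list (map (\<lambda>x. s * snd x) u) = s * snd (ev u)"
          by (simp add: snd_ev sum_list_const_mult)
        also have "\<dots> = k" using Cons.prems(3) ss by (simp flip: mult.assoc)
        finally have "\<exists>u1 y u2. u = u1 @ y # u2 \<and> s * snd y = 1
            \<and> sum_list (map (\<lambda>x. s * snd x) u1) = k - 1"
          using False Cons.prems jk u assms(1)
          by (intro prefix_sum_eq) (auto simp: letters_def spot_def step_def)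
        then obtain u1 y u2 where split: "u = u1 @ y # u2" and y: "s * snd y = 1"
          and u1: "s * snd (ev u1) = k - 1"
          by (auto simp: snd_ev sum_list_const_mult)
        have "s * (s * snd (ev u1)) = s * (k - 1)" using u1 by simp
        then have u1': "snd (ev u1) = s * (k - 1)" using ss by (simp flip: mult.assoc)
        have mem: "u1 \<in> lists letters" "u2 \<in> lists letters" "y \<in> letters"
          using u split by auto
        from mem(3) assms(1) have y_step: "y = step s"
          by (cases rule: letter_cases) (use y ss in \<open>auto simp: step_def\<close>)
        have u2: "snd (ev u2) = 0"
          using Cons.prems(3) u1' split y_step by (simp add: snd_ev step_def algebra_simps)
        have v': "snd (ev v) = - s * (k - 1)"
          using Cons.prems(3,4) x_back by (simp add: snd_ev step_def algebra_simps)
        \<comment> \<open>The part \<open>y # u2 @ [x]\<close> is a loop at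
          \<open>s * (k - 1)\<close>. It is taken out, and the rest is rearranged to end at that
          site.\<close>
        have "\<exists>w \<in> lists letters. ev w = (fst (ev (u1 @ v)), s * (k - 1))
            \<and> length w \<le> length u1 + length v"
          using mem v u1' v' False Cons.prems jk
          by (intro Cons.IH[of _ "k - 1"]) (auto simp: snd_ev)
        then obtain w where w: "w \<in> lists letters" "ev w = (fst (ev (u1 @ v)), s * (k - 1))"
          "length w \<le> length u1 + length v" by blast
        \<comment> \<open>Since \<open>w\<close> ends where the loop was based,
          \<open>y # u2\<close> acts on the same sites as before. Its contribution commutes past
          that of \<open>v\<close>, and without \<open>x\<close> the walk ends at
          \<open>s * k\<close>.\<close>
        have "ev (w @ y # u2) = (fst (ev (u @ x # v)), s * j)"
        proof -
          have "ev (u1 @ y # u2 @ x # v)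
              = ev u1 \<otimes>\<^bsub>W\<^esub> (y \<otimes>\<^bsub>W\<^esub> (ev u2 \<otimes>\<^bsub>W\<^esub> (x \<otimes>\<^bsub>W\<^esub> ev v)))"
            using mem v x by (simp add: ev_append)
          moreover have "ev (w @ y # u2) = ev w \<otimes>\<^bsub>W\<^esub> (y \<otimes>\<^bsub>W\<^esub> ev u2)"
            using mem w by (simp add: ev_append)
          moreover have "ev (u1 @ v) = ev u1 \<otimes>\<^bsub>W\<^esub> ev v"
            using mem v by (simp add: ev_append)
          ultimately show ?thesis
            using mem v u1' u2 jk ev_carrier[of u1] ev_carrier[of u2] ev_carrier[of v]
            by (simp add: w(2) split x_back y_step step_def mult_W m_ac algebra_simps)
        qed
        then show ?thesis
          using w mem split by (intro bexI[of _ "w @ y # u2"]) auto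
      qed
    qed
  qed
qed

text \<open>Only a letter \<open>spot\<close> read at head position \<open>i - p\<close> can change
  the value at \<open>p\<close>.\<close>

lemma support_visited:
  assumes "w \<in> lists letters" "fst (ev w) p \<noteq> \<one>"
  shows "\<exists>u v. w = u @ v \<and> snd (ev u) = i - p"
  using assms
proof (induction w arbitrary: p)
  case Nil
  then show ?case by (simp add: one_W)
next
  case (Cons x w)
  show ?case
  proof (cases "p = i")
    case True
    then have "x # w = [] @ (x # w) \<and> snd (ev []) = i - p" by (simp add: one_W)
    then show ?thesis by blast
  next
    case False
    then have "fst x p = \<one>"
      using Cons by (auto simp: letters_def spot_def step_def)
    then have "fst (ev w) (p + snd x) \<noteq> \<one>"
      using Cons.prems by (auto simp: mult_W)
    then obtain u v where "w = u @ v" "snd (ev u) = i - (p + snd x)"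
      using Cons by (meson Cons_in_lists_iff)
    then show ?thesis
      by (intro exI[of _ "x # u"] exI[of _ v]) (simp add: mult_W)
  qed
qed

text \<open>A closed walk realising \<open>f\<close> must visit the head position
  \<open>i - p\<close>, and is cut open on its way back from there.\<close>

lemma ball_shift_head:
  assumes "(f, 0) \<in> ball n" "f p \<noteq> \<one>"
  shows "\<exists>s \<in> {1, -1}. \<forall>j. 0 \<le> j \<and> j \<le> \<bar>p - i\<bar> \<longrightarrow> (f, s * j) \<in> ball n"
proof -
  obtain w where w: "w \<in> lists letters" "length w \<le> n" "ev w = (f, 0)"
    using assms unfolding ball_def by force
  then obtain u v where uv: "w = u @ v" "snd (ev u) = i - p"
    using support_visited[of w p] assms by auto
  \<comment> \<open>The direction of the excursion, chosen so that
    \<open>s * \<bar>p - i\<bar> = i - p\<close>.\<close>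
  define s :: int where "s = (if i \<ge> p then 1 else -1)"
  have "(f, s * j) \<in> ball n" if "0 \<le> j" "j \<le> \<bar>p - i\<bar>" for j
  proof -
    have "\<exists>w' \<in> lists letters. ev w' = (fst (ev (u @ v)), s * j) \<and> length w' \<le> length u + length v"
      using that w uv by (intro walk_surgery[where k = "\<bar>p - i\<bar>"]) (auto simp: s_def)
    then show ?thesis using w uv unfolding ball_def by force
  qed
  then show ?thesis by (intro bexI[of _ s]) (auto simp: s_def)
qed

section \<open>Size of balls and of their coordinates\<close>

lemma ball_carrier: "ball n \<subseteq> carrier W"
  unfolding ball_def using ev_carrier by blast

lemma finite_ball: "finite (ball n)"
proof -
  have "ball n \<subseteq> ev ` {w. set w \<subseteq> letters \<and> length w \<le> n}"
    by (auto simp: ball_def)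
  then show ?thesis
    using finite_lists_length_le[OF finite_letters] finite_surj by blast
qed

lemma ball_snd_le:
  assumes "x \<in> ball n"
  shows "\<bar>snd x\<bar> \<le> int n"
proof -
  have "\<bar>snd (ev w)\<bar> \<le> int (length w)" if "w \<in> lists letters" for w
    using that by (induction w) (auto simp: mult_W one_W letters_def spot_def step_def)
  then show ?thesis using assms by (force simp: ball_def)
qed

text \<open>Each letter changes the exponent at a site by at most 1. Hence a site takes at most
  \<open>2 * n + 1\<close> values, whether \<open>c\<close> has finite or infinite order.\<close>

lemma ball_fst_mem:
  assumes "x \<in> ball n"
  shows "fst x p \<in> (\<lambda>e::int. c [^] e) ` {- int n..int n}"
proof -
  have "\<exists>e::int. \<bar>e\<bar> \<le> int (length w) \<and> fst (ev w) p = c [^] e" if "w \<in> lists letters" for w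
    using that
  proof (induction w arbitrary: p)
    case (Cons x w)
    then obtain e :: int where e: "\<bar>e\<bar> \<le> int (length w)" "fst (ev w) (p + snd x) = c [^] e"
      by (meson Cons_in_lists_iff)
    have "x \<in> letters" using Cons by simp
    then have "fst x p = c [^] (0::int) \<or> fst x p = c [^] (1::int) \<or> fst x p = c [^] (-1::int)"
      by (auto simp: letters_def spot_def step_def int_pow_neg)
    then obtain d :: int where d: "\<bar>d\<bar> \<le> 1" "fst x p = c [^] d"
      using that[of 0] that[of 1] that[of "-1"] by auto
    then have "fst (ev (x # w)) p = c [^] (d + e)"
      using e by (simp add: mult_W int_pow_mult)
    then show ?case using d e by (intro exI[of _ "d + e"]) auto
  qed (auto simp: one_W intro: exI[of _ 0])
  then obtain e :: int where "\<bar>e\<bar> \<le> int n" "fst x p = c [^] e"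
    using assms by (force simp: ball_def)
  then show ?thesis by (intro image_eqI[of _ _ e]) auto
qed

text \<open>A bit string is written on the sites \<open>i\<close>, \<open>i - 1\<close>, and so on,
  by a walk in one direction that spends at most two letters per bit. The string can be read off
  from the resulting element.\<close>

lemma card_ball_ge: "2 ^ (n div 2) \<le> card (ball n)"
proof -
  define wd where "wd bs = concat (map (\<lambda>b. if b then [spot c, step 1] else [step 1]) bs)"
    for bs :: "bool list"
  let ?L = "{bs::bool list. length bs = n div 2}"
  have [simp]: "wd [] = []" "wd (b # bs) = (if b then [spot c, step 1] else [step 1]) @ wd bs"
    for b bs by (simp_all add: wd_def)
  have mem: "wd bs \<in> lists letters" for bs
    by (induction bs) (auto simp: letters_def)
  have len: "length (wd bs) \<le> 2 * length bs" for bs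
    by (induction bs) auto
  have car: "fst (ev (wd bs)) p \<in> carrier C" for bs p
    using ev_carrier[OF mem] by simp
  \<comment> \<open>The walk only moves the writing site down from \<open>i\<close>, so the first
    bit stays alone at \<open>i\<close> and the later bits appear shifted by one.\<close>
  have triv: "fst (ev (wd bs)) p = \<one>" if "p > i" for bs p
    using that by (induction bs arbitrary: p) (auto simp: mult_W one_W spot_def step_def)
  have head: "fst (ev (wd (b # bs))) i = (if b then c else \<one>)" for b bs
    using triv[of "i + 1" bs] by (auto simp: mult_W spot_def step_def)
  have tail: "fst (ev (wd (b # bs))) (p - 1) = fst (ev (wd bs)) p" if "p \<le> i" for b bs p
    using that car by (auto simp: mult_W spot_def step_def)
  have "bs = bs'" if "length bs = length bs'" "ev (wd bs) = ev (wd bs')" for bs bs'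
    using that
  proof (induction rule: list_induct2)
    case (Cons b bs b' bs')
    have "b = b'" using head[of b bs] head[of b' bs'] Cons.prems c_nontrivial
      by (metis (full_types))
    moreover have "fst (ev (wd bs)) p = fst (ev (wd bs')) p" for p
      using triv[of p] tail[of p] Cons.prems by (metis not_le)
    moreover have "snd (ev (wd bs)) = snd (ev (wd bs'))"
      using Cons.prems \<open>b = b'\<close> by (auto simp: mult_W split: if_splits)
    ultimately show ?case using Cons.IH by (auto simp: prod_eq_iff)
  qed simp
  then have "inj_on (\<lambda>bs. ev (wd bs)) ?L" by (auto simp: inj_on_def)
  moreover have "(\<lambda>bs. ev (wd bs)) ` ?L \<subseteq> ball n"
  proof (rule image_subsetI)
    fix bs assume "bs \<in> ?L"
    then have "length (wd bs) \<le> n" using len[of bs] by simp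
    with mem show "ev (wd bs) \<in> ball n" by (auto simp: ball_def)
  qed
  ultimately have "card ?L \<le> card (ball n)"
    using finite_ball by (rule card_inj_on_le)
  moreover have "card ?L = 2 ^ (n div 2)"
    using card_lists_length_eq[of "UNIV :: bool set" "n div 2"] by simp
  ultimately show ?thesis by simp
qed

lemma card_ball_pos: "card (ball n) > 0"
  using card_ball_ge[of n] by (metis less_le_trans zero_less_numeral zero_less_power)

section \<open>Density of the base in balls\<close>

text \<open>With head component 0, such an element is determined by its values on the
  \<open>2 * m + 1\<close> sites around \<open>i\<close>.\<close>

lemma card_near:
  "card {x \<in> ball n \<inter> base. \<forall>p. fst x p \<noteq> \<one> \<longrightarrow> \<bar>p - i\<bar> < int m} \<le> (2 * n + 1) ^ (2 * m + 1)"
  (is "card ?N \<le> _")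
proof -
  let ?I = "{i - int m..i + int m}"
  let ?V = "(\<lambda>e::int. c [^] e) ` {- int n..int n}"
  have V: "card ?V \<le> 2 * n + 1"
    by (rule order_trans[OF card_image_le]) auto
  have "inj_on (\<lambda>x. restrict (fst x) ?I) ?N"
  proof (rule inj_onI)
    fix x y assume xy: "x \<in> ?N" "y \<in> ?N" and eq: "restrict (fst x) ?I = restrict (fst y) ?I"
    have "fst x p = fst y p" for p
    proof (cases "p \<in> ?I")
      case True
      then show ?thesis using fun_cong[OF eq, of p] by simp
    next
      case False
      then have "\<not> \<bar>p - i\<bar> < int m" by auto
      then have "fst x p = \<one>" "fst y p = \<one>" using xy by blast+
      then show ?thesis by simp
    qed
    then show "x = y" using xy by (auto simp: prod_eq_iff base_def)
  qed
  moreover have "(\<lambda>x. restrict (fst x) ?I) ` ?N \<subseteq> ?I \<rightarrow>\<^sub>E ?V"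
    using ball_fst_mem by (auto simp: PiE_iff)
  moreover have "finite (?I \<rightarrow>\<^sub>E ?V)" by (intro finite_PiE) auto
  ultimately have "card ?N \<le> card (?I \<rightarrow>\<^sub>E ?V)" by (rule card_inj_on_le)
  also have "\<dots> = card ?V ^ (2 * m + 1)" by (simp add: card_PiE nat_add_distrib nat_mult_distrib)
  also have "\<dots> \<le> (2 * n + 1) ^ (2 * m + 1)" using V by (rule power_mono) simp
  finally show ?thesis .
qed

text \<open>Each such \<open>x\<close> yields \<open>m + 1\<close> elements of the ball, with the
  same base component and head components \<open>s x * j\<close> for \<open>j\<close> from 0 to
  \<open>m\<close>. The base component gives back \<open>x\<close>, hence also the sign
  \<open>s x\<close> and then \<open>j\<close>.\<close>

lemma card_far:
  "Suc m * card {x \<in> ball n \<inter> base. \<exists>p. fst x p \<noteq> \<one> \<and> int m \<le> \<bar>p - i\<bar>} \<le> card (ball n)"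
  (is "_ * card ?F \<le> _")
proof -
  have "\<forall>x \<in> ?F. \<exists>s. s \<in> {1, -1} \<and> (\<forall>j. 0 \<le> j \<and> j \<le> int m \<longrightarrow> (fst x, s * j) \<in> ball n)"
  proof
    fix x assume "x \<in> ?F"
    then obtain p where p: "(fst x, 0) \<in> ball n" "fst x p \<noteq> \<one>" "int m \<le> \<bar>p - i\<bar>"
      by (cases x) (auto simp: base_def)
    from ball_shift_head[OF p(1,2)] p(3)
    show "\<exists>s. s \<in> {1, -1} \<and> (\<forall>j. 0 \<le> j \<and> j \<le> int m \<longrightarrow> (fst x, s * j) \<in> ball n)"
      by (meson order_trans)
  qed
  from bchoice[OF this] obtain s where s: "\<And>x. x \<in> ?F \<Longrightarrow> s x \<in> {1, -1 :: int}"
    "\<And>x j. x \<in> ?F \<Longrightarrow> 0 \<le> j \<Longrightarrow> j \<le> int m \<Longrightarrow> (fst x, s x * j) \<in> ball n"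
    by blast
  let ?g = "\<lambda>(x, j). (fst x, s x * int j)"
  have "inj_on ?g (?F \<times> {..m})"
  proof (rule inj_onI)
    fix y z assume y: "y \<in> ?F \<times> {..m}" and z: "z \<in> ?F \<times> {..m}" and eq: "?g y = ?g z"
    obtain x j x' j' where yz: "y = (x, j)" "z = (x', j')" by (cases y; cases z)
    then have "x = x'" using y z eq by (auto simp: base_def prod_eq_iff)
    moreover have "s x \<noteq> 0" using s(1)[of x] y yz by auto
    ultimately show "y = z" using eq yz by auto
  qed
  moreover have "?g ` (?F \<times> {..m}) \<subseteq> ball n"
  proof (rule image_subsetI)
    fix y assume "y \<in> ?F \<times> {..m}"
    then obtain x j where "y = (x, j)" "x \<in> ?F" "j \<le> m" by blast
    then show "?g y \<in> ball n" using s(2)[of x "int j"] by simp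
  qed
  ultimately have "card (?F \<times> {..m}) \<le> card (ball n)"
    using finite_ball by (rule card_inj_on_le)
  then show ?thesis by (simp add: card_cartesian_product mult.commute)
qed

lemma card_base_le:
  "real (card (ball n \<inter> base)) \<le> real (card (ball n)) / real (Suc m) + real ((2 * n + 1) ^ (2 * m + 1))"
proof -
  let ?F = "{x \<in> ball n \<inter> base. \<exists>p. fst x p \<noteq> \<one> \<and> int m \<le> \<bar>p - i\<bar>}"
  let ?N = "{x \<in> ball n \<inter> base. \<forall>p. fst x p \<noteq> \<one> \<longrightarrow> \<bar>p - i\<bar> < int m}"
  have "ball n \<inter> base = ?F \<union> ?N" by (auto simp: not_le)
  then have "card (ball n \<inter> base) \<le> card ?F + card ?N" using card_Un_le[of ?F ?N] by presburger
  then have "real (card (ball n \<inter> base)) \<le> real (card ?F) + real (card ?N)" by linarith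
  moreover have "real (card ?N) \<le> real ((2 * n + 1) ^ (2 * m + 1))"
    using card_near by (rule of_nat_mono)
  moreover have "real (card ?F) \<le> real (card (ball n)) / real (Suc m)"
  proof -
    have "real (Suc m * card ?F) \<le> real (card (ball n))" using card_far by (rule of_nat_mono)
    then show ?thesis by (simp add: field_simps)
  qed
  ultimately show ?thesis by linarith
qed

section \<open>Counting commuting pairs\<close>

text \<open>Two elements that commute with \<open>x\<close> and have the same head component differ
  on a finite set of sites stable under translation by \<open>snd x\<close>, which is nonzero. So
  they agree, and the head component counts them.\<close>

lemma card_commuting_le:
  assumes "x \<in> ball n" "x \<notin> base"
  shows "card {y \<in> ball n. x \<otimes>\<^bsub>W\<^esub> y = y \<otimes>\<^bsub>W\<^esub> x} \<le> 2 * n + 1" (is "card ?Z \<le> _")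
proof -
  have "inj_on snd ?Z"
  proof (rule inj_onI)
    fix y z assume y: "y \<in> ?Z" and z: "z \<in> ?Z" and eq: "snd y = snd z"
    have car: "x \<in> carrier W" "y \<in> carrier W" "z \<in> carrier W"
      using assms y z ball_carrier by auto
    let ?D = "{p. fst y p \<noteq> fst z p}"
    have "?D = {}"
    proof (rule finite_shift_closed_int_empty)
      have "?D \<subseteq> {p. fst y p \<noteq> \<one>} \<union> {p. fst z p \<noteq> \<one>}" by auto
      then show "finite ?D" using car by (auto simp: carrier_W intro: finite_subset)
      show "snd x \<noteq> 0" using assms by (simp add: base_def)
      fix p assume "p \<in> ?D"
      have comm: "fst x p \<otimes> fst u (p + snd x) = fst u p \<otimes> fst x (p + snd u)" if "u \<in> ?Z" for u
        using that by (auto simp: mult_W dest!: fun_cong[of _ _ p])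
      show "p + snd x \<in> ?D"
      proof
        show "fst y (p + snd x) \<noteq> fst z (p + snd x)"
        proof
          \<comment> \<open>Agreement at \<open>p + snd x\<close> would, by cancelling a common
            factor in the two commutation equations, give agreement at \<open>p\<close>.\<close>
          assume "fst y (p + snd x) = fst z (p + snd x)"
          then have "fst y p \<otimes> fst x (p + snd y) = fst z p \<otimes> fst x (p + snd y)"
            using comm[OF y] comm[OF z] eq by simp
          with \<open>p \<in> ?D\<close> show False using car by simp
        qed
      qed
    qed
    with eq show "y = z" by (auto simp: prod_eq_iff)
  qed
  moreover have "snd ` ?Z \<subseteq> {- int n..int n}"
    using ball_snd_le by (fastforce simp: abs_le_iff)
  ultimately have "card ?Z \<le> card {- int n..int n}" by (rule card_inj_on_le) simp
  then show ?thesis by simp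
qed

text \<open>Pairs with both entries in the base are bounded by all such pairs. The factor 2 accounts
  for the remaining pairs, with the first or the second entry outside the base.\<close>

lemma card_commuting_pairs_le:
  "card {(x, y). x \<in> ball n \<and> y \<in> ball n \<and> x \<otimes>\<^bsub>W\<^esub> y = y \<otimes>\<^bsub>W\<^esub> x}
    \<le> (card (ball n \<inter> base))\<^sup>2 + 2 * ((2 * n + 1) * card (ball n))" (is "card ?Q \<le> _")
proof -
  let ?Z = "\<lambda>x. {y \<in> ball n. x \<otimes>\<^bsub>W\<^esub> y = y \<otimes>\<^bsub>W\<^esub> x}"
  let ?R = "SIGMA x : ball n - base. ?Z x"
  let ?P = "ball n \<inter> base"
  have fin: "finite (?Z x)" for x using finite_ball by simp
  have finR: "finite ?R" using finite_ball fin by blast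
  have "card ?R = (\<Sum>x\<in>ball n - base. card (?Z x))"
    using finite_ball fin by (simp add: card_SigmaI)
  also have "\<dots> \<le> (\<Sum>x\<in>ball n - base. 2 * n + 1)"
    using card_commuting_le by (intro sum_mono) blast
  also have "\<dots> = (2 * n + 1) * card (ball n - base)" by simp
  also have "\<dots> \<le> (2 * n + 1) * card (ball n)"
    using finite_ball by (intro mult_left_mono card_mono) auto
  finally have R: "card ?R \<le> (2 * n + 1) * card (ball n)" .
  have "card ?Q \<le> card (?P \<times> ?P \<union> (?R \<union> prod.swap ` ?R))"
    by (rule card_mono) (use finR finite_ball in \<open>auto simp: image_iff\<close>)
  also have "\<dots> \<le> card (?P \<times> ?P) + (card ?R + card (prod.swap ` ?R))"
    by (meson add_left_mono card_Un_le order_trans)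
  also have "\<dots> \<le> (card ?P)\<^sup>2 + (card ?R + card ?R)"
    using card_image_le[OF finR, of prod.swap]
    by (simp add: card_cartesian_product power2_eq_square)
  finally show ?thesis using R by linarith
qed

section \<open>Passage to the limit\<close>

lemma poly_over_ball: "(\<lambda>n. real ((2 * n + 1) ^ d) / real (card (ball n))) \<longlonglongrightarrow> 0"
proof (rule tendsto_sandwich)
  show "\<forall>\<^sub>F n in sequentially. 0 \<le> real ((2 * n + 1) ^ d) / real (card (ball n))" by simp
  have "real ((2 * n + 1) ^ d) / real (card (ball n))
      \<le> (2 * real n + 1) ^ d / 2 powr (real n / 2 - 1)" for n
  proof (rule frac_le)
    show "real ((2 * n + 1) ^ d) \<le> (2 * real n + 1) ^ d" by (simp add: add.commute)
    \<comment> \<open>Rounding in \<open>n div 2\<close> costs less than 1 in the exponent; the real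
      exponent gives a form open to \<open>real_asymp\<close>.\<close>
    have "2 powr (real n / 2 - 1) \<le> 2 powr real (n div 2)"
      by (intro powr_mono) auto
    also have "\<dots> = real (2 ^ (n div 2))" by (simp add: powr_realpow)
    also have "\<dots> \<le> real (card (ball n))" using card_ball_ge by (rule of_nat_mono)
    finally show "2 powr (real n / 2 - 1) \<le> real (card (ball n))" .
  qed auto
  then show "\<forall>\<^sub>F n in sequentially. real ((2 * n + 1) ^ d) / real (card (ball n))
      \<le> (2 * real n + 1) ^ d / 2 powr (real n / 2 - 1)" by simp
  show "(\<lambda>n. (2 * real n + 1) ^ d / 2 powr (real n / 2 - 1)) \<longlonglongrightarrow> 0" by real_asymp
qed simp

text \<open>First \<open>m\<close> is fixed to make \<open>1 / (m + 1)\<close> small. The other term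
  is then a polynomial in \<open>n\<close> of fixed degree, which the exponential growth of balls
  beats.\<close>

lemma base_negligible: "(\<lambda>n. real (card (ball n \<inter> base)) / real (card (ball n))) \<longlonglongrightarrow> 0"
proof (rule LIMSEQ_I)
  fix r :: real assume "0 < r"
  then obtain m where m: "1 / real (Suc m) < r / 2"
    using nat_approx_posE[of "r / 2"] by auto
  let ?q = "\<lambda>n. real ((2 * n + 1) ^ (2 * m + 1)) / real (card (ball n))"
  have le: "real (card (ball n \<inter> base)) / real (card (ball n)) \<le> 1 / real (Suc m) + ?q n" for n
    using divide_right_mono[OF card_base_le[of n m], of "real (card (ball n))"] card_ball_pos[of n]
    by (simp add: add_divide_distrib)
  obtain N where N: "\<And>n. n \<ge> N \<Longrightarrow> norm (?q n - 0) < r / 2"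
    using LIMSEQ_D[OF poly_over_ball, of "r / 2" "2 * m + 1"] \<open>0 < r\<close> by auto
  show "\<exists>N. \<forall>n\<ge>N. norm (real (card (ball n \<inter> base)) / real (card (ball n)) - 0) < r"
  proof (intro exI allI impI)
    fix n assume "N \<le> n"
    then have "?q n < r / 2" using N[of n] by simp
    then have "real (card (ball n \<inter> base)) / real (card (ball n)) < r" using le[of n] m by linarith
    then show "norm (real (card (ball n \<inter> base)) / real (card (ball n)) - 0) < r" by simp
  qed
qed

lemma commuting_density_tendsto_0:
  "(\<lambda>n. real (card {(x, y). x \<in> ball n \<and> y \<in> ball n \<and> x \<otimes>\<^bsub>W\<^esub> y = y \<otimes>\<^bsub>W\<^esub> x})
      / (real (card (ball n)))\<^sup>2) \<longlonglongrightarrow> 0" (is "?f \<longlonglongrightarrow> 0")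
proof (rule tendsto_sandwich)
  \<comment> \<open>The bound for commuting pairs divided by the squared size of the ball; the
    exponent 1 matches the case \<open>d = 1\<close> of \<open>poly_over_ball\<close>.\<close>
  let ?g = "\<lambda>n. (real (card (ball n \<inter> base)) / real (card (ball n)))\<^sup>2
      + 2 * (real ((2 * n + 1) ^ 1) / real (card (ball n)))"
  show "\<forall>\<^sub>F n in sequentially. 0 \<le> ?f n" by simp
  have "?f n \<le> ?g n" for n
  proof -
    let ?b = "real (card (ball n))"
    have "?f n \<le> real ((card (ball n \<inter> base))\<^sup>2 + 2 * ((2 * n + 1) * card (ball n))) / ?b\<^sup>2"
      using card_commuting_pairs_le by (intro divide_right_mono of_nat_mono) simp_all
    also have "\<dots> = ?g n"
      using card_ball_pos[of n] by (simp add: field_simps power2_eq_square)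
    finally show ?thesis .
  qed
  then show "\<forall>\<^sub>F n in sequentially. ?f n \<le> ?g n" by simp
  have "?g \<longlonglongrightarrow> 0\<^sup>2 + 2 * 0"
    by (intro tendsto_intros base_negligible poly_over_ball)
  then show "?g \<longlonglongrightarrow> 0" by simp
qed simp

section \<open>Word metric and the given generators\<close>

text \<open>Generation ensures that every element is the value of some word, so that the
  \<open>LEAST\<close> in \<open>word_length\<close> is attained.\<close>

lemma word_ball_eq:
  assumes L: "S \<union> m_inv W ` S = letters" and gen: "generate W S = carrier W"
  shows "word_ball W S n = ball n"
proof -
  have S: "S \<subseteq> letters" "m_inv W ` S \<subseteq> letters" using L by auto
  have word: "\<exists>w \<in> lists letters. ev w = g" if "g \<in> carrier W" for g
  proof -
    have "g \<in> generate W S" using that gen by simp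
    then show ?thesis
    proof induction
      case one
      then show ?case by (intro bexI[of _ "[]"]) simp_all
    next
      case (incl h)
      then show ?case using S letters_carrier by (intro bexI[of _ "[h]"]) auto
    next
      case (inv h)
      then show ?case using S letters_carrier by (intro bexI[of _ "[inv\<^bsub>W\<^esub> h]"]) auto
    next
      case (eng g h)
      then obtain u v where "u \<in> lists letters" "ev u = g" "v \<in> lists letters" "ev v = h" by blast
      then show ?case by (intro bexI[of _ "u @ v"]) (auto simp: ev_append)
    qed
  qed
  have length_eq: "word_length W S g = (LEAST k. \<exists>w. length w = k \<and> w \<in> lists letters \<and> ev w = g)" for g
    by (simp add: word_length_def L ev_def lists_eq_set)
  show ?thesis
  proof (intro equalityI subsetI)
    fix g assume "g \<in> word_ball W S n"
    then have g: "g \<in> carrier W" "word_length W S g \<le> n" by (auto simp: word_ball_def)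
    have "\<exists>k w. length w = k \<and> w \<in> lists letters \<and> ev w = g" using word[OF g(1)] by blast
    from LeastI_ex[OF this] show "g \<in> ball n"
      using g(2) unfolding length_eq ball_def by auto
  next
    fix g assume "g \<in> ball n"
    then obtain w where w: "w \<in> lists letters" "ev w = g" "length w \<le> n" by (auto simp: ball_def)
    then have "word_length W S g \<le> length w" unfolding length_eq by (intro Least_le) blast
    then show "g \<in> word_ball W S n" using w ev_carrier by (auto simp: word_ball_def)
  qed
qed

lemma deg_comm_eq_0:
  assumes "S \<union> m_inv W ` S = letters" "generate W S = carrier W"
  shows "deg_comm W S = 0"
proof -
  have "(\<lambda>n. ereal (real (card {(x, y). x \<in> ball n \<and> y \<in> ball n \<and> x \<otimes>\<^bsub>W\<^esub> y = y \<otimes>\<^bsub>W\<^esub> x})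
      / (real (card (ball n)))\<^sup>2)) \<longlonglongrightarrow> ereal 0"
    using commuting_density_tendsto_0 by (rule tendsto_ereal)
  from lim_imp_Limsup[OF _ this] show ?thesis
    by (simp add: deg_comm_def word_ball_eq[OF assms])
qed

end

theorem theorem1:
  fixes C :: "('a, 'b) monoid_scheme"
    and a t :: "(int \<Rightarrow> 'a) \<times> int"
    and i :: int
  assumes "group C"
    and "cyclic_group C"
    and "\<not> trivial_group C"
    and "a \<in> wreath_copy C integer_group i"
    and "t \<in> wreath_head C integer_group"
    and "generate (wreath_product C integer_group) {a, t} =
      carrier (wreath_product C integer_group)"
  shows "deg_comm (wreath_product C integer_group) {a, t} = 0"
proof -
  interpret comm_group C using assms(1,2) by (rule group.cyclic_imp_abelian_group)
  obtain z where z: "z \<in> carrier C" "z \<noteq> \<one>\<^bsub>C\<^esub>"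
    using assms(1,3) by (auto simp: trivial_group_def)
  \<comment> \<open>A provisional instance with an arbitrary nontrivial \<open>z\<close>: it gives
    access to coordinates before the value of \<open>a\<close> at \<open>i\<close> is known to be
    nontrivial.\<close>
  interpret Z: wreath_int C i z by unfold_locales (use z in auto)
  define c where "c = fst a i"
  have a_W: "a \<in> carrier Z.W" and c: "c \<in> carrier C" and a: "a = Z.spot c"
    using assms(4)
    by (auto simp: c_def Z.W_def Z.spot_def wreath_copy_def wreath_product_def carrier_wreath_base)
  obtain d where t: "t = Z.step d"
    using assms(5) by (auto simp: Z.step_def wreath_head_def one_wreath_base restrict_def)
  have gen: "generate Z.W {a, t} = carrier Z.W" using assms(6) by (simp add: Z.W_def)
  \<comment> \<open>Two properties preserved by products and inverses. Tested on
    \<open>step 1\<close> and on \<open>spot z\<close>, they force \<open>d\<close> to be a unit and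
    \<open>c\<close> to be nontrivial.\<close>
  have gens: "d dvd snd x \<and> (c = \<one>\<^bsub>C\<^esub> \<longrightarrow> fst x = (\<lambda>_. \<one>\<^bsub>C\<^esub>))" if "x \<in> carrier Z.W" for x
  proof -
    have "x \<in> generate Z.W {a, t}" using that gen by simp
    then show ?thesis
    proof induction
      case (inv h)
      then show ?case using c by (auto simp: a t Z.inv_spot Z.inv_step, auto simp: Z.spot_def Z.step_def)
    qed (auto simp: a t Z.one_W Z.mult_W Z.spot_def Z.step_def)
  qed
  have "d dvd 1" using gens[OF Z.step_carrier[of 1]] by (simp add: Z.step_def)
  then have d: "d = 1 \<or> d = -1" by auto
  have "c \<noteq> \<one>\<^bsub>C\<^esub>"
    using gens[OF Z.spot_carrier[OF z(1)]] z by (auto simp: Z.spot_def dest: fun_cong[of _ _ i])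
  then interpret G: wreath_int C i c by unfold_locales (use c in auto)
  have "{a, t} \<union> m_inv G.W ` {a, t} = G.letters"
    using d c by (auto simp: a t G.letters_def G.inv_spot G.inv_step)
  moreover have "generate G.W {a, t} = carrier G.W" using assms(6) by (simp add: G.W_def)
  ultimately show ?thesis using G.deg_comm_eq_0 by (simp add: G.W_def)
qed

end
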